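(* Let $\Delta\ge 1$ and $k\ge 0$ be integers such that $\Delta\le k+1$ if $\Delta$ is odd, and $\Delta\le k+2$ if $\Delta$ is even. Then every instance $(G,D,\Delta)$ of DiTTR with minimum slack parameter $k$ (i.e. $D_{u,v}\ge\hat d(u,v)+k$ for all vertices $u,v$) is feasible.
   Context: All graphs are finite. A $\Delta$-periodic labeling of a directed graph $G=(V,E)$ is a map $\lambda:E\to\{0,1,\dots,\Delta-1\}$; edge $e$ is then active exactly at the times $\lambda(e)+i\Delta$, $i\in\mathbb{N}_0$. A temporal $s$-$z$-path is a sequence $(v_{i-1},v_i,t_i)_{i=1}^{\ell}$ with $v_0=s$, $v_\ell=z$, pairwise distinct vertices $v_0,\dots,v_\ell$, $(v_{i-1},v_i)\in E$ active at time $t_i$ for every $i$, and $t_1<t_2<\dots<t_\ell$ (strictly increasing). Its duration is $t_\ell+1-t_1$. A fastest temporal path is one of minimum duration. $\hat d(u,v)$ is the distance from $u$ to $v$ in the static graph $G$ (all edges have unit length). A bidirected tree is the directed graph obtained from an undirected tree by replacing each edge $\{u,v\}$ by the two directed edges $(u,v),(v,u)$ (which may get different labels). An instance of DiTTR is a triple $(G,D,\Delta)$ with $G=(V,E)$ a bidirected tree, $D$ a matrix indexed by $V\times V$ with entries positive integers or $\infty$ (no restriction) such that $D_{u,v}\ge \hat d(u,v)$ for all $u,v$, and $\Delta$ a positive integer. It is feasible (realizable) if there is a $\Delta$-periodic labeling $\lambda$ of $E$ such that, for all $u,v\in V$, the duration of a fastest temporal path from $u$ to $v$ is at most $D_{u,v}$.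 Diagonal entries of $D$ play no role; all conditions on $D$ are for distinct vertices. *)

theory Defs
  imports "Graph_Theory.Graph_Theory" "HOL-Library.Extended_Nat" "HOL-Library.Extended_Real"
begin

definition undirected_tree :: "'a set \<Rightarrow> 'a set set \<Rightarrow> bool" where
  "undirected_tree V E \<longleftrightarrow>
     finite V \<and> V \<noteq> {} \<and>
     (\<forall>e\<in>E. \<exists>u\<in>V. \<exists>v\<in>V. u \<noteq> v \<and> e = {u, v}) \<and>
     (\<forall>u\<in>V. \<forall>v\<in>V. (u, v) \<in> {(x, y). {x, y} \<in> E}\<^sup>*) \<and>
     (\<nexists>c. 3 \<le> length c \<and> distinct c \<and>
          (\<forall>i<length c. {c ! i, c ! (Suc i mod length c)} \<in> E))"

definition bidirected_tree :: "'a pair_pre_digraph \<Rightarrow> bool" where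
  "bidirected_tree G \<longleftrightarrow>
     (\<exists>E. undirected_tree (pverts G) E \<and> parcs G = {(u, v). {u, v} \<in> E})"

text \<open>Distance in the static graph: all arcs have unit weight.\<close>
definition static_dist :: "'a pair_pre_digraph \<Rightarrow> 'a \<Rightarrow> 'a \<Rightarrow> ereal" where
  "static_dist G u v = wf_digraph.\<mu> (with_proj G) (\<lambda>_. 1) u v"

definition periodic_labeling :: "'a pair_pre_digraph \<Rightarrow> nat \<Rightarrow> ('a \<times> 'a \<Rightarrow> nat) \<Rightarrow> bool" where
  "periodic_labeling G \<Delta> l \<longleftrightarrow> (\<forall>e\<in>parcs G. l e < \<Delta>)"

definition active :: "nat \<Rightarrow> ('a \<times> 'a \<Rightarrow> nat) \<Rightarrow> 'a \<times> 'a \<Rightarrow> nat \<Rightarrow> bool" where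
  "active \<Delta> l e t \<longleftrightarrow> (\<exists>i. t = l e + i * \<Delta>)"

text \<open>An entry \<open>((x, y), t)\<close> of the list is a traversal of the arc \<open>(x, y)\<close> at time \<open>t\<close>;
  \<open>apath\<close> makes the underlying walk visit pairwise distinct vertices.\<close>
definition temporal_path ::
  "'a pair_pre_digraph \<Rightarrow> nat \<Rightarrow> ('a \<times> 'a \<Rightarrow> nat) \<Rightarrow> 'a \<Rightarrow> (('a \<times> 'a) \<times> nat) list \<Rightarrow> 'a \<Rightarrow> bool" where
  "temporal_path G \<Delta> l s p z \<longleftrightarrow>
     p \<noteq> [] \<and>
     pre_digraph.apath (with_proj G) s (map fst p) z \<and>
     (\<forall>(e, t)\<in>set p. active \<Delta> l e t) \<and>
     sorted_wrt (<) (map snd p)"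

definition duration :: "(('a \<times> 'a) \<times> nat) list \<Rightarrow> nat" where
  "duration p = snd (last p) + 1 - snd (hd p)"

text \<open>The infimum is attained whenever a temporal path exists, and is \<open>\<infinity>\<close> otherwise.\<close>
definition fastest_duration ::
  "'a pair_pre_digraph \<Rightarrow> nat \<Rightarrow> ('a \<times> 'a \<Rightarrow> nat) \<Rightarrow> 'a \<Rightarrow> 'a \<Rightarrow> enat" where
  "fastest_duration G \<Delta> l u v = (INF p\<in>{p. temporal_path G \<Delta> l u p v}. enat (duration p))"

text \<open>Only the entries of \<open>D\<close> at pairs of distinct vertices are relevant, here and below.\<close>
definition slack_at_least :: "'a pair_pre_digraph \<Rightarrow> ('a \<Rightarrow> 'a \<Rightarrow> enat) \<Rightarrow> nat \<Rightarrow> bool" where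
  "slack_at_least G D k \<longleftrightarrow>
     (\<forall>u\<in>pverts G. \<forall>v\<in>pverts G. u \<noteq> v \<longrightarrow>
        static_dist G u v + ereal (real k) \<le> ereal_of_enat (D u v))"

definition dittr_instance :: "'a pair_pre_digraph \<Rightarrow> ('a \<Rightarrow> 'a \<Rightarrow> enat) \<Rightarrow> nat \<Rightarrow> bool" where
  "dittr_instance G D \<Delta> \<longleftrightarrow>
     bidirected_tree G \<and> 0 < \<Delta> \<and>
     (\<forall>u\<in>pverts G. \<forall>v\<in>pverts G. u \<noteq> v \<longrightarrow>
        0 < D u v \<and> static_dist G u v \<le> ereal_of_enat (D u v))"

definition feasible :: "'a pair_pre_digraph \<Rightarrow> ('a \<Rightarrow> 'a \<Rightarrow> enat) \<Rightarrow> nat \<Rightarrow> bool" where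
  "feasible G D \<Delta> \<longleftrightarrow>
     (\<exists>l. periodic_labeling G \<Delta> l \<and>
        (\<forall>u\<in>pverts G. \<forall>v\<in>pverts G. u \<noteq> v \<longrightarrow> fastest_duration G \<Delta> l u v \<le> D u v))"

end

theory Submission
  imports Defs
begin

text \<open>
  Root the tree and let \<open>h\<close> be the depth. Label the arc from a child to its parent \<open>y\<close> by
  \<open>- h y\<close> and the arc from a parent \<open>x\<close> to a child by \<open>h x + 1\<close>, modulo \<open>\<Delta>\<close>. Every path first
  ascends and then descends, and it never waits except at its topmost vertex \<open>w\<close>, where it
  waits \<open>2 * h w mod \<Delta>\<close> steps. This is at most \<open>\<Delta> - 1\<close>, and at most \<open>\<Delta> - 2\<close> for even \<open>\<Delta>\<close>.
\<close>

section \<open>Depth in a tree\<close>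

lemma rtrancl_imp_distinct_path:
  assumes "(x, z) \<in> Q\<^sup>*"
  shows "\<exists>xs. xs \<noteq> [] \<and> hd xs = x \<and> last xs = z \<and> distinct xs \<and>
    successively (\<lambda>a b. (a, b) \<in> Q) xs"
  using assms
proof (induction rule: converse_rtrancl_induct)
  case base
  then show ?case by (intro exI[of _ "[z]"]) simp
next
  case (step x y)
  then obtain xs where xs: "xs \<noteq> []" "hd xs = y" "last xs = z" "distinct xs"
    "successively (\<lambda>a b. (a, b) \<in> Q) xs" by blast
  show ?case
  proof (cases "x \<in> set xs")
    case True
    \<comment> \<open>A path that already meets \<open>x\<close> is cut back to its suffix starting
      at \<open>x\<close>.\<close>
    then obtain as bs where "xs = as @ x # bs" by (meson split_list)
    with xs show ?thesis
      by (intro exI[of _ "x # bs"]) (auto simp: successively_append_iff)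
  next
    case False
    with xs step(1) show ?thesis
      by (intro exI[of _ "x # xs"]) (auto simp: successively_Cons)
  qed
qed

lemma undirected_tree_edgeD:
  assumes "undirected_tree V E" "{x, y} \<in> E"
  shows "x \<in> V" "y \<in> V" "x \<noteq> y"
proof -
  have "\<forall>e\<in>E. \<exists>u\<in>V. \<exists>v\<in>V. u \<noteq> v \<and> e = {u, v}"
    using assms(1) by (simp add: undirected_tree_def)
  then obtain u v where "u \<in> V" "v \<in> V" "u \<noteq> v" "{x, y} = {u, v}"
    using assms(2) by blast
  then show "x \<in> V" "y \<in> V" "x \<noteq> y" by (auto simp: doubleton_eq_iff)
qed

text \<open>Otherwise a simple path from \<open>x\<close> to \<open>x'\<close> avoiding
  \<open>y\<close>, closed up through \<open>y\<close>, would be a cycle.\<close>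

lemma undirected_tree_connected_neighbours_eq:
  assumes "undirected_tree V E" "{x, y} \<in> E" "{x', y} \<in> E"
    and conn: "(x, x') \<in> {(a, b). {a, b} \<in> E \<and> a \<noteq> y \<and> b \<noteq> y}\<^sup>*"
  shows "x = x'"
proof (rule ccontr)
  assume ne: "x \<noteq> x'"
  obtain xs where xs: "xs \<noteq> []" "hd xs = x" "last xs = x'" "distinct xs"
    and succ: "successively (\<lambda>a b. (a, b) \<in> {(a, b). {a, b} \<in> E \<and> a \<noteq> y \<and> b \<noteq> y}) xs"
    using rtrancl_imp_distinct_path[OF conn] by blast
  have step: "{xs ! i, xs ! Suc i} \<in> E \<and> xs ! i \<noteq> y \<and> xs ! Suc i \<noteq> y"
    if "Suc i < length xs" for i
    using succ that by (auto simp: successively_conv_nth)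
  have len: "2 \<le> length xs"
    using xs ne by (cases xs; cases "tl xs") auto
  have y: "y \<notin> set xs"
  proof
    assume "y \<in> set xs"
    then obtain i where i: "i < length xs" "xs ! i = y" by (auto simp: in_set_conv_nth)
    show False
    proof (cases i)
      case 0
      then show False using i step[of 0] len by auto
    next
      case (Suc j)
      then show False using i step[of j] by auto
    qed
  qed
  \<comment> \<open>Index 0 is the edge from \<open>y\<close> to \<open>x\<close>, the last index
    wraps around from \<open>x'\<close> to \<open>y\<close>, and every other index is a step of
    \<open>xs\<close>.\<close>
  have "{(y # xs) ! i, (y # xs) ! (Suc i mod length (y # xs))} \<in> E" if "i < length (y # xs)" for i
  proof (cases i)
    case 0
    then show ?thesis using len assms(2) xs by (cases xs) (auto simp: insert_commute)
  next
    case (Suc j)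
    show ?thesis
    proof (cases "Suc j < length xs")
      case True
      then show ?thesis using Suc step[of j] by simp
    next
      case False
      then have "j = length xs - 1" "Suc i = length (y # xs)" using that Suc by auto
      then show ?thesis using Suc xs assms(3) by (simp add: last_conv_nth)
    qed
  qed
  moreover have "3 \<le> length (y # xs)" "distinct (y # xs)" using len y xs by auto
  ultimately show False using assms(1) unfolding undirected_tree_def by blast
qed

text \<open>The depth is the distance from an arbitrary root \<open>r\<close>. Two neighbours of
  \<open>y\<close> that are no deeper than \<open>y\<close> are both joined to \<open>r\<close>
  without passing through \<open>y\<close>, so acyclicity makes them equal.\<close>

lemma undirected_tree_depth:
  assumes tree: "undirected_tree V E"
  obtains h :: "'a \<Rightarrow> nat" where
    "\<And>x y. {x, y} \<in> E \<Longrightarrow> h x = Suc (h y) \<or> h y = Suc (h x)"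
    "\<And>x x' y. {x, y} \<in> E \<Longrightarrow> {x', y} \<in> E \<Longrightarrow> h y = Suc (h x) \<Longrightarrow> h y = Suc (h x') \<Longrightarrow> x = x'"
proof -
  let ?R = "{(x, y). {x, y} \<in> E}"
  obtain r where r: "r \<in> V" using tree unfolding undirected_tree_def by blast
  note edge_V = undirected_tree_edgeD(1,2)[OF tree]
  define h where "h x = (LEAST n. (r, x) \<in> ?R ^^ n)" for x
  have h_walk: "(r, x) \<in> ?R ^^ h x" if "x \<in> V" for x
  proof -
    have "(r, x) \<in> ?R\<^sup>*" using tree r that unfolding undirected_tree_def by blast
    then show ?thesis unfolding h_def by (auto dest: rtrancl_imp_relpow intro: LeastI)
  qed
  have h_le: "h x \<le> n" if "(r, x) \<in> ?R ^^ n" for x n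
    unfolding h_def using that by (rule Least_le)
  have h_step: "h y \<le> Suc (h x)" if "{x, y} \<in> E" for x y
    using h_le[of y "Suc (h x)"] h_walk[of x] edge_V that by auto
  \<comment> \<open>The parent is the last vertex before \<open>x\<close> on a shortest walk from
    the root.\<close>
  have parent: "\<exists>p. {p, x} \<in> E \<and> h x = Suc (h p)" if x: "x \<in> V" "h x \<noteq> 0" for x
  proof -
    obtain n where n: "h x = Suc n" using x(2) by (cases "h x") auto
    then obtain p where p: "(r, p) \<in> ?R ^^ n" "{p, x} \<in> E"
      using h_walk[OF x(1)] by auto
    then show ?thesis using h_le[OF p(1)] h_step[OF p(2)] n by auto
  qed
  have root: "x = r" if "x \<in> V" "h x = 0" for x
    using h_walk[OF that(1)] that(2) by simp
  \<comment> \<open>Following parents from \<open>x\<close>, all later vertices have depth below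
    \<open>h y\<close>, so the walk never meets \<open>y\<close>.\<close>
  have to_root: "(x, r) \<in> {(a, b). {a, b} \<in> E \<and> a \<noteq> y \<and> b \<noteq> y}\<^sup>*"
    if "x \<in> V" "x \<noteq> y" "h x \<le> h y" for x y
    using that
  proof (induction "h x" arbitrary: x)
    case 0
    then show ?case using root[of x] by simp
  next
    case (Suc n)
    then obtain p where p: "{p, x} \<in> E" "h x = Suc (h p)" using parent[of x] by auto
    then have "p \<noteq> y" using Suc by auto
    then have "(p, r) \<in> {(a, b). {a, b} \<in> E \<and> a \<noteq> y \<and> b \<noteq> y}\<^sup>*"
      using Suc p edge_V[OF p(1)] by simp
    moreover have "(x, p) \<in> {(a, b). {a, b} \<in> E \<and> a \<noteq> y \<and> b \<noteq> y}"
      using p \<open>p \<noteq> y\<close> Suc by (simp add: insert_commute)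
    ultimately show ?case by (rule converse_rtrancl_into_rtrancl[rotated])
  qed
  \<comment> \<open>The weak inequalities matter: this also serves below to exclude edges between
    vertices of equal depth.\<close>
  have unique: "x = x'"
    if e: "{x, y} \<in> E" "{x', y} \<in> E" and le: "h x \<le> h y" "h x' \<le> h y" for x x' y
  proof -
    let ?Q = "{(a, b). {a, b} \<in> E \<and> a \<noteq> y \<and> b \<noteq> y}"
    have ne: "x \<noteq> y" "x' \<noteq> y" using undirected_tree_edgeD(3)[OF tree] e by blast+
    have sym: "sym ?Q" by (rule symI) (simp add: insert_commute)
    have "(x, r) \<in> ?Q\<^sup>*" by (rule to_root[OF edge_V(1)[OF e(1)] ne(1) le(1)])
    also have "(r, x') \<in> ?Q\<^sup>*"
      by (rule symD[OF sym_rtrancl[OF sym] to_root[OF edge_V(1)[OF e(2)] ne(2) le(2)]])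
    finally show ?thesis by (rule undirected_tree_connected_neighbours_eq[OF tree e])
  qed
  show thesis
  proof (rule that[of h])
    fix x y assume e: "{x, y} \<in> E"
    have "h x \<noteq> h y"
    proof
      assume eq: "h x = h y"
      show False
      proof (cases "h y = 0")
        case True
        then have "x = y" using eq root edge_V[OF e] by auto
        then show False using undirected_tree_edgeD(3)[OF tree e] by blast
      next
        case False
        then obtain p where p: "{p, y} \<in> E" "h y = Suc (h p)"
          using parent edge_V[OF e] by blast
        \<comment> \<open>A neighbour \<open>x\<close> at the depth of \<open>y\<close> would
          coincide with the parent \<open>p\<close>, which is one level higher.\<close>
        then show False using unique[OF e p(1)] eq by auto
      qed
    qed
    then show "h x = Suc (h y) \<or> h y = Suc (h x)"
      using h_step[OF e] h_step[of y x] e by (auto simp: insert_commute)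
  qed (auto intro: unique)
qed

section \<open>Paths ascend and then descend\<close>

lemma pcas_ascending:
  assumes "pcas u p v" "\<forall>e\<in>set p. h (fst e) = Suc (h (snd e))"
  shows "h v + length p = h u" "i < length p \<Longrightarrow> Suc (h (snd (p ! i)) + i) = h u"
  using assms by (induction p arbitrary: u i) (auto simp: nth_Cons split: nat.split)

lemma pcas_descending:
  assumes "pcas u p v" "\<forall>e\<in>set p. h (snd e) = Suc (h (fst e))" "i < length p"
  shows "h (fst (p ! i)) = h u + i"
  using assms by (induction p arbitrary: u i) (auto simp: nth_Cons split: nat.split)

lemma pcas_append: "pcas u (p @ q) v \<longleftrightarrow> (\<exists>w. pcas u p w \<and> pcas w q v)"
  by (induction p arbitrary: u) auto

text \<open>An ascent right after a descent would lead back to the unique parent, that is, to the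
  vertex just left, and a simple path cannot do this.\<close>

lemma simple_path_ascends_then_descends:
  assumes step: "\<And>x y. (x, y) \<in> A \<Longrightarrow> h x = Suc (h y) \<or> h y = Suc (h x)"
    and parent: "\<And>x x' y. (x, y) \<in> A \<Longrightarrow> (y, x') \<in> A \<Longrightarrow>
      h y = Suc (h x) \<Longrightarrow> h y = Suc (h x') \<Longrightarrow> x = x'"
    and "set p \<subseteq> A" "pcas u p v" "distinct (pawalk_verts u p)"
  shows "\<exists>us ds. p = us @ ds \<and> (\<forall>e\<in>set us. h (fst e) = Suc (h (snd e))) \<and>
    (\<forall>e\<in>set ds. h (snd e) = Suc (h (fst e)))"
  using assms(3-5)
proof (induction p arbitrary: u)
  case Nil
  then show ?case by simp
next
  case (Cons e p)
  then obtain us ds where p: "p = us @ ds"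
    and us: "\<forall>e\<in>set us. h (fst e) = Suc (h (snd e))"
    and ds: "\<forall>e\<in>set ds. h (snd e) = Suc (h (fst e))"
    using Cons.IH[of "snd e"] by auto
  show ?case
  proof (cases "h (fst e) = Suc (h (snd e))")
    case True
    then show ?thesis using p us ds by (intro exI[of _ "e # us"] exI[of _ ds]) auto
  next
    case False
    then have down: "h (snd e) = Suc (h (fst e))"
      using step[of "fst e" "snd e"] Cons.prems by auto
    have "us = []"
    proof (cases us)
      case (Cons f us')
      have "e \<in> A" "f \<in> A" "fst f = snd e"
        using Cons.prems p Cons by auto
      then have "(fst e, snd e) \<in> A" "(snd e, snd f) \<in> A"
        by (metis prod.collapse)+
      then have "snd f = fst e"
        using parent[of "fst e" "snd e" "snd f"] down us Cons.prems p Cons by auto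
      \<comment> \<open>The case split exposes \<open>snd f\<close> as the third vertex of the path,
        where it repeats the first vertex \<open>fst e\<close>.\<close>
      then show ?thesis using Cons.prems(3) p Cons by (cases "us' @ ds") (use Cons.prems(2) in auto)
    qed simp
    then show ?thesis using p ds down by (intro exI[of _ "[]"] exI[of _ "e # ds"]) auto
  qed
qed

section \<open>The labeling\<close>

text \<open>The summand \<open>h y * (\<Delta> - 1)\<close> is \<open>- h y\<close> modulo \<open>\<Delta>\<close>, kept inside \<open>nat\<close>.\<close>
definition depth_labeling :: "nat \<Rightarrow> ('a \<Rightarrow> nat) \<Rightarrow> 'a \<times> 'a \<Rightarrow> nat" where
  "depth_labeling \<Delta> h = (\<lambda>(x, y).
     if h x = Suc (h y) then (h y * (\<Delta> - 1)) mod \<Delta> else Suc (h x) mod \<Delta>)"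

lemma active_iff_mod:
  assumes "l e < \<Delta>"
  shows "active \<Delta> l e t \<longleftrightarrow> t mod \<Delta> = l e"
proof
  assume "t mod \<Delta> = l e"
  then have "t = l e + t div \<Delta> * \<Delta>" using div_mult_mod_eq[of t \<Delta>] by simp
  then show "active \<Delta> l e t" unfolding active_def by blast
qed (use assms in \<open>auto simp: active_def\<close>)

text \<open>For even \<Delta> the residue of an even number is even, hence at most \<Delta> - 2; for
  odd \<Delta> only the bound \<Delta> - 1 remains.\<close>

lemma double_mod_le:
  fixes \<Delta> k :: nat
  assumes "0 < \<Delta>" "odd \<Delta> \<Longrightarrow> \<Delta> \<le> k + 1" "even \<Delta> \<Longrightarrow> \<Delta> \<le> k + 2"
  shows "2 * n mod \<Delta> \<le> k"
proof (cases "even \<Delta>")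
  case True
  then have "even (2 * n mod \<Delta>)" by (simp add: dvd_mod_iff)
  moreover have "2 * n mod \<Delta> < \<Delta>" using assms(1) by simp
  ultimately show ?thesis using assms(3)[OF True] True
    by (auto elim!: evenE[of \<Delta>] evenE[of "2 * n mod \<Delta>"])
next
  case False
  then show ?thesis using assms mod_less_divisor[of \<Delta> "2 * n"] by linarith
qed

text \<open>The arcs of \<open>us\<close> are used at consecutive times, and so are those of
  \<open>ds\<close>, with a single wait in between at the turning vertex \<open>w\<close>. The bound
  is an inequality because a path without ascent or without descent does not wait.\<close>

lemma temporal_path_depth_labeling:
  assumes \<Delta>: "0 < \<Delta>"
    and path: "pre_digraph.apath (with_proj G) u (us @ ds) v" "us @ ds \<noteq> []"
    and us: "\<forall>e\<in>set us. h (fst e) = Suc (h (snd e))"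
    and ds: "\<forall>e\<in>set ds. h (snd e) = Suc (h (fst e))"
  shows "\<exists>q w. temporal_path G \<Delta> (depth_labeling \<Delta> h) u q v \<and>
    duration q \<le> length (us @ ds) + 2 * h w mod \<Delta>"
proof -
  interpret pair_pre_digraph G .
  obtain w where w: "pcas u us w" "pcas w ds v"
    using path(1) by (auto simp: apath_def awalk_def pcas_append)
  define m n where "m = length us" and "n = length ds"
  \<comment> \<open>Modulo \<Delta>, an arc ascending to \<open>w\<close> has label
    \<open>- h w\<close> and an arc descending from \<open>w\<close> has label
    \<open>h w + 1\<close>. The gap is \<open>2 * h w + 1\<close>, and one unit of it is the
    ordinary step.\<close>
  define wait where "wait = 2 * h w mod \<Delta>"
  \<comment> \<open>This is \<open>1 - h u\<close> modulo \<Delta>, the label of the arc from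
    \<open>u\<close> to a parent at depth \<open>h u - 1\<close>.\<close>
  define t0 where "t0 = Suc (h u * (\<Delta> - 1))"
  define t1 where "t1 = t0 + m + wait"
  define ts where "ts = [t0..<t0 + m] @ [t1..<t1 + n]"
  define q where "q = zip (us @ ds) ts"
  have lab: "depth_labeling \<Delta> h e < \<Delta>" for e
    using \<Delta> by (simp add: depth_labeling_def split: prod.split)
  have len: "length ts = length (us @ ds)" by (simp add: ts_def m_def n_def)
  have fst_q: "map fst q = us @ ds" and snd_q: "map snd q = ts"
    using len by (simp_all add: q_def)
  have hu: "h u = h w + m" using pcas_ascending(1)[OF w(1) us] by (simp add: m_def)
  have act_up: "active \<Delta> (depth_labeling \<Delta> h) (us ! i) (t0 + i)" if i: "i < m" for i
  proof -
    let ?y = "snd (us ! i)"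
    have up: "h (fst (us ! i)) = Suc (h ?y)" using us i by (simp add: m_def)
    have hy: "h u = Suc (h ?y + i)" using pcas_ascending(2)[OF w(1) us] i by (simp add: m_def)
    \<comment> \<open>An exact identity in \<open>nat\<close>; writing \<Delta> as a successor
      removes the truncated subtraction.\<close>
    have "t0 + i = h ?y * (\<Delta> - 1) + Suc i * \<Delta>"
      using \<Delta> hy by (cases \<Delta>) (auto simp: t0_def algebra_simps)
    then have "(t0 + i) mod \<Delta> = depth_labeling \<Delta> h (us ! i)"
      using up mod_mult_self1[of _ "Suc i" \<Delta>] by (simp only: depth_labeling_def split_beta if_True refl)
    then show ?thesis using active_iff_mod[of "depth_labeling \<Delta> h", OF lab] by blast
  qed
  have act_down: "active \<Delta> (depth_labeling \<Delta> h) (ds ! i) (t1 + i)" if i: "i < n" for i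
  proof -
    have down: "h (snd (ds ! i)) = Suc (h (fst (ds ! i)))" using ds i by (simp add: n_def)
    have hx: "h (fst (ds ! i)) = h w + i" using pcas_descending[OF w(2) ds] i by (simp add: n_def)
    have "h u * (\<Delta> - 1) + m + 2 * h w = h u * \<Delta> + h w"
      using \<Delta> hu by (cases \<Delta>) (auto simp: algebra_simps)
    then have "(t0 + m + 2 * h w + i) = Suc (h w + i) + h u * \<Delta>"
      by (simp add: t0_def)
    moreover have "(t1 + i) mod \<Delta> = (t0 + m + 2 * h w + i) mod \<Delta>"
      unfolding t1_def wait_def by (metis mod_add_left_eq mod_add_right_eq)
    ultimately have "(t1 + i) mod \<Delta> = Suc (h w + i) mod \<Delta>" by (simp only: mod_mult_self1)
    then have "(t1 + i) mod \<Delta> = depth_labeling \<Delta> h (ds ! i)"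
      using down hx by (simp add: depth_labeling_def split_beta)
    then show ?thesis using active_iff_mod[of "depth_labeling \<Delta> h", OF lab] by blast
  qed
  have "active \<Delta> (depth_labeling \<Delta> h) e t" if "(e, t) \<in> set q" for e t
  proof -
    have "q = zip us [t0..<t0 + m] @ zip ds [t1..<t1 + n]"
      by (simp add: q_def ts_def m_def)
    with that show ?thesis using act_up act_down
      by (auto simp: set_zip m_def n_def)
  qed
  moreover have "sorted_wrt (<) ts"
    by (auto simp: ts_def sorted_wrt_append t1_def)
  moreover have "q \<noteq> []" using fst_q path(2) by auto
  ultimately have "temporal_path G \<Delta> (depth_labeling \<Delta> h) u q v"
    using path(1) fst_q snd_q by (auto simp: temporal_path_def)
  moreover have "duration q \<le> length (us @ ds) + wait"
  proof -
    have "duration q = last ts + 1 - hd ts"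
      using \<open>q \<noteq> []\<close> snd_q by (auto simp: duration_def last_map hd_map)
    also have "\<dots> \<le> m + n + wait"
      \<comment> \<open>If \<open>m = 0\<close> the first time is \<open>t1\<close>, and if
        \<open>n = 0\<close> the last is \<open>t0 + m - 1\<close>; in both cases the wait drops
        out.\<close>
      using path(2) by (cases "m = 0"; cases "n = 0")
        (auto simp: ts_def t1_def m_def n_def hd_append last_append)
    finally show ?thesis by (simp add: m_def n_def)
  qed
  ultimately show ?thesis unfolding wait_def by blast
qed

theorem theorem7:
  fixes G :: "'a pair_pre_digraph" and D :: "'a \<Rightarrow> 'a \<Rightarrow> enat" and \<Delta> k :: nat
  assumes "1 \<le> \<Delta>"
    and "odd \<Delta> \<Longrightarrow> \<Delta> \<le> k + 1"
    and "even \<Delta> \<Longrightarrow> \<Delta> \<le> k + 2"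
    and "dittr_instance G D \<Delta>"
    and "slack_at_least G D k"
  shows "feasible G D \<Delta>"
proof -
  obtain E where tree: "undirected_tree (pverts G) E" and arcs: "parcs G = {(u, v). {u, v} \<in> E}"
    using assms(4) unfolding dittr_instance_def bidirected_tree_def by blast
  obtain h :: "'a \<Rightarrow> nat" where
    step: "\<And>x y. {x, y} \<in> E \<Longrightarrow> h x = Suc (h y) \<or> h y = Suc (h x)" and
    parent: "\<And>x x' y. {x, y} \<in> E \<Longrightarrow> {x', y} \<in> E \<Longrightarrow> h y = Suc (h x) \<Longrightarrow> h y = Suc (h x') \<Longrightarrow> x = x'"
    using undirected_tree_depth[OF tree] by blast
  have sub: "parcs G \<subseteq> pverts G \<times> pverts G"
    using undirected_tree_edgeD[OF tree] unfolding arcs by blast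
  have fin: "finite (pverts G)" using tree by (simp add: undirected_tree_def)
  interpret pair_fin_digraph G
    by unfold_locales (use sub fin finite_subset[OF sub] in auto)
  let ?l = "depth_labeling \<Delta> h"
  have "fastest_duration G \<Delta> ?l u v \<le> D u v"
    if uv: "u \<in> pverts G" "v \<in> pverts G" "u \<noteq> v" for u v
  proof (cases "D u v")
    case (enat d)
    have slack: "static_dist G u v + ereal (real k) \<le> ereal_of_enat (D u v)"
      using assms(5) uv unfolding slack_at_least_def by blast
    \<comment> \<open>A finite entry of \<open>D\<close> forces a finite distance, so a shortest
      path exists and is simple.\<close>
    have "\<mu> (\<lambda>_. 1) u v < \<infinity>"
      using slack enat by (auto simp: static_dist_def)
    from min_cost_awalk[OF \<mu>_reach_conv[THEN iffD1, OF this], of "\<lambda>_. 1"]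
    obtain p where p: "apath u p v" "\<mu> (\<lambda>_. 1) u v = awalk_cost (\<lambda>_. 1) p"
      by auto
    have "awalk_cost (\<lambda>_. 1) p = real (length p)" by (induction p) auto
    then have d: "length p + k \<le> d"
      using slack enat p(2) by (simp add: static_dist_def)
    obtain us ds where p_split: "p = us @ ds"
      and us: "\<forall>e\<in>set us. h (fst e) = Suc (h (snd e))"
      and ds: "\<forall>e\<in>set ds. h (snd e) = Suc (h (fst e))"
    proof -
      have "\<exists>us ds. p = us @ ds \<and> (\<forall>e\<in>set us. h (fst e) = Suc (h (snd e))) \<and>
        (\<forall>e\<in>set ds. h (snd e) = Suc (h (fst e)))"
      proof (rule simple_path_ascends_then_descends[where A = "parcs G"])
        show "set p \<subseteq> parcs G" "pcas u p v" "distinct (pawalk_verts u p)"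
          using p(1) by (auto simp: apath_def awalk_def)
      qed (use step parent in \<open>auto simp: arcs insert_commute\<close>)
      then show thesis using that by blast
    qed
    have "p \<noteq> []" using p(1) uv(3) by (auto simp: apath_Nil_iff)
    then obtain q w where q: "temporal_path G \<Delta> ?l u q v"
      "duration q \<le> length p + 2 * h w mod \<Delta>"
      using temporal_path_depth_labeling[of \<Delta> G u us ds v h] assms(1) p(1) p_split us ds by auto
    \<comment> \<open>The slack \<open>k\<close> pays for the one wait, whichever vertex
      \<open>w\<close> is.\<close>
    have "2 * h w mod \<Delta> \<le> k" using double_mod_le assms(1-3) by simp
    then have "duration q \<le> d" using q(2) d by linarith
    moreover have "fastest_duration G \<Delta> ?l u v \<le> enat (duration q)"
      unfolding fastest_duration_def using q(1) by (auto intro: INF_lower)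
    ultimately show ?thesis using enat by (auto intro: order_trans)
  qed simp
  moreover have "periodic_labeling G \<Delta> ?l"
    using assms(1) by (auto simp: periodic_labeling_def depth_labeling_def)
  ultimately show ?thesis unfolding feasible_def by blast
qed

end
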